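(* Let $f:\mathbb{R}^d\to\mathbb{R}$ be differentiable and convex and admit a minimizer, and suppose $f$ is matrix smooth with matrix $\mathbb{L}$ and the sketch moment conditions hold (both as in the context). Consider the full-sketch case $r=d$, and assume that $P_kP_k^\top=I_d$ for all $k\ge0$ (which is the case, for example, for the Haar and block coordinate sketches with $r=d$). Then the sketch moment conditions are satisfied with $\omega=1$, $\ell=1$. With this choice of $\omega,\ell$, the $(x_k,y_k)$-sequence generated by algorithm RS-NAG-C (as in the context) from $x_0$ coincides with classical two-sequence Nesterov accelerated gradient (NAG) for convex objectives started at $x_0$, i.e. $x_k=x_k^{\mathrm N}$ and $y_k=y_k^{\mathrm N}$ for all $k\ge0$, where $x_0^{\mathrm N}=y_0^{\mathrm N}=x_0$, $t_0=1$, and for $k\ge0$ $$x_{k+1}^{\mathrm N}=y_k^{\mathrm N}-\tfrac1L\nabla f(y_k^{\mathrm N}),\quad t_{k+1}=\frac{1+\sqrt{1+4t_k^2}}{2},\quad \beta_k=\frac{t_k-1}{t_{k+1}},\quad y_{k+1}^{\mathrm N}=x_{k+1}^{\mathrm N}+\beta_k(x_{k+1}^{\mathrm N}-x_k^{\mathrm N}).$$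
   Context: Standing assumption: $d\ge2$. $\|\cdot\|$ is the Euclidean norm for vectors and the induced operator norm for matrices; $A\preceq B$ means $B-A$ is positive semidefinite. Matrix smoothness: there is a fixed symmetric matrix $\mathbb{L}\in\mathbb{R}^{d\times d}$, $\mathbb{L}\succeq0$, $\mathbb{L}\ne0$, such that for all $x,y\in\mathbb{R}^d$, $f(y)\le f(x)+\langle\nabla f(x),y-x\rangle+\tfrac12(y-x)^\top\mathbb{L}(y-x)$. Put $L:=\|\mathbb{L}\|$. Sketch moment conditions with constants $\omega>0,\ell>0$ for a random matrix $P\in\mathbb{R}^{d\times r}$: $\mathbb{E}[PP^\top]=I_d$, $\mathbb{E}[(PP^\top)^2]\preceq\omega I_d$, $\mathbb{E}[PP^\top\mathbb{L}PP^\top]\preceq\ell L\,I_d$. The sketches $P_k$ are i.i.d. copies of $P$. Haar sketch: $P=\sqrt{d/r}\,R$ with $R$ the first $r$ columns of a Haar-distributed orthogonal $d\times d$ matrix. (Block) coordinate sketch: $P=\sqrt{d/r}\,S$ with $S$ consisting of $r$ uniformly sampled distinct columns of $I_d$. Algorithm RS-NAG-C: given $x_0\in\mathbb{R}^d$ and i.i.d. sketches $P_k$, set $m=1/(2L\ell)$, $A_0=0$, $z_0=x_0$, and for $k=0,1,2,\dots$: $a_{k+1}=\dfrac{m+\sqrt{m^2+2\omega mA_k}}{\omega}$, $A_{k+1}=A_k+a_{k+1}$, $y_k=\dfrac{A_k}{A_{k+1}}x_k+\dfrac{a_{k+1}}{A_{k+1}}z_k$, $x_{k+1}=y_k-\dfrac1{L\ell}P_kP_k^\top\nabla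 f(y_k)$, $z_{k+1}=z_k-a_{k+1}P_kP_k^\top\nabla f(y_k)$. *)

theory Defs
  imports "HOL-Probability.Probability"
begin

definition psd :: "real^'n^'n \<Rightarrow> bool" where
  "psd A \<longleftrightarrow> transpose A = A \<and> (\<forall>x. 0 \<le> x \<bullet> (A *v x))"

definition loewner_le :: "real^'n^'n \<Rightarrow> real^'n^'n \<Rightarrow> bool"  (infix "\<preceq>" 50) where
  "A \<preceq> B \<longleftrightarrow> psd (B - A)"

abbreviation op_norm :: "real^'n^'n \<Rightarrow> real" where
  "op_norm A \<equiv> onorm ((*v) A)"

definition gradient :: "(real^'n \<Rightarrow> real) \<Rightarrow> real^'n \<Rightarrow> real^'n" where
  "gradient f x = (THE g. GDERIV f x :> g)"

definition matrix_smooth :: "real^'n^'n \<Rightarrow> (real^'n \<Rightarrow> real) \<Rightarrow> bool" where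
  "matrix_smooth \<L> f \<longleftrightarrow> psd \<L> \<and> \<L> \<noteq> 0 \<and>
     (\<forall>x y. f y \<le> f x + gradient f x \<bullet> (y - x) + 1/2 * ((y - x) \<bullet> (\<L> *v (y - x))))"

abbreviation gram :: "real^'r^'d \<Rightarrow> real^'d^'d" where
  "gram S \<equiv> S ** transpose S"

text \<open>Integrability is stated explicitly because the Bochner integral of a non-integrable function is 0.\<close>

definition sketch_moments ::
    "'w measure \<Rightarrow> ('w \<Rightarrow> real^'r^'d) \<Rightarrow> real^'d^'d \<Rightarrow> real \<Rightarrow> real \<Rightarrow> bool" where
  "sketch_moments M P \<L> \<omega> l \<longleftrightarrow>
     \<omega> > 0 \<and> l > 0 \<and> P \<in> borel_measurable M \<and>
     integrable M (\<lambda>w. gram (P w)) \<and>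
     integrable M (\<lambda>w. gram (P w) ** gram (P w)) \<and>
     integrable M (\<lambda>w. gram (P w) ** \<L> ** gram (P w)) \<and>
     (\<integral>w. gram (P w) \<partial>M) = mat 1 \<and>
     (\<integral>w. gram (P w) ** gram (P w) \<partial>M) \<preceq> \<omega> *\<^sub>R mat 1 \<and>
     (\<integral>w. gram (P w) ** \<L> ** gram (P w) \<partial>M) \<preceq> (l * op_norm \<L>) *\<^sub>R mat 1"

definition iid_copies ::
    "'w measure \<Rightarrow> ('w \<Rightarrow> real^'r^'d) \<Rightarrow> (nat \<Rightarrow> 'w \<Rightarrow> real^'r^'d) \<Rightarrow> bool" where
  "iid_copies M P Ps \<longleftrightarrow>
     prob_space.indep_vars M (\<lambda>_. borel) Ps UNIV \<and>
     (\<forall>k. distr M borel (Ps k) = distr M borel P)"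

text \<open>
  On the compact group of orthogonal matrices, Haar measure is the unique left-invariant
  probability measure.
\<close>

definition haar_orthogonal :: "'w measure \<Rightarrow> ('w \<Rightarrow> real^'d^'d) \<Rightarrow> bool" where
  "haar_orthogonal M Q \<longleftrightarrow>
     Q \<in> borel_measurable M \<and> (AE w in M. orthogonal_matrix (Q w)) \<and>
     (\<forall>U. orthogonal_matrix U \<longrightarrow> distr M borel (\<lambda>w. U ** Q w) = distr M borel Q)"

text \<open>
  The index types carry no order, so the choice of the first \<open>r\<close> columns is given by a
  deterministic injection \<open>c\<close> that lists them.  By invariance of Haar measure the law of the
  sketch does not depend on \<open>c\<close>.
\<close>

definition haar_sketch :: "'w measure \<Rightarrow> ('w \<Rightarrow> real^'r^'d) \<Rightarrow> bool" where
  "haar_sketch M P \<longleftrightarrow>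
     (\<exists>(Q :: 'w \<Rightarrow> real^'d^'d) (c :: 'r \<Rightarrow> 'd). haar_orthogonal M Q \<and> inj c \<and>
        (\<forall>w\<in>space M. P w = sqrt (real CARD('d) / real CARD('r)) *\<^sub>R (\<chi> i j. Q w $ i $ c j)))"

text \<open>
  Column \<open>j\<close> of the sampled matrix is column \<open>s w j\<close> of the identity.  The set of sampled
  columns is uniform among the \<open>r\<close>-element sets; the order in which they are listed is
  left arbitrary, which covers ordered as well as unordered sampling without replacement.
\<close>

definition coordinate_sketch :: "'w measure \<Rightarrow> ('w \<Rightarrow> real^'r^'d) \<Rightarrow> bool" where
  "coordinate_sketch M P \<longleftrightarrow>
     (\<exists>s :: 'w \<Rightarrow> 'r \<Rightarrow> 'd. s \<in> measurable M (count_space UNIV) \<and> (AE w in M. inj (s w)) \<and>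
        distr M (count_space UNIV) (\<lambda>w. range (s w)) =
          measure_pmf (pmf_of_set {B :: 'd set. card B = CARD('r)}) \<and>
        (\<forall>w\<in>space M. P w = sqrt (real CARD('d) / real CARD('r)) *\<^sub>R
           (\<chi> i j. (mat 1 :: real^'d^'d) $ i $ s w j)))"

text \<open>
  In the following, \<open>g\<close> is the gradient map, \<open>L\<close> the operator norm of the
  smoothness matrix, and \<open>S\<close> one realization of the sequence of sketches.
  The value \<open>rs_nag_a m \<omega> 0\<close> is never used.
\<close>

fun rs_nag_A :: "real \<Rightarrow> real \<Rightarrow> nat \<Rightarrow> real"
  and rs_nag_a :: "real \<Rightarrow> real \<Rightarrow> nat \<Rightarrow> real" where
  "rs_nag_A m \<omega> 0 = 0"
| "rs_nag_A m \<omega> (Suc k) = rs_nag_A m \<omega> k + rs_nag_a m \<omega> (Suc k)"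
| "rs_nag_a m \<omega> 0 = 0"
| "rs_nag_a m \<omega> (Suc k) = (m + sqrt (m\<^sup>2 + 2 * \<omega> * m * rs_nag_A m \<omega> k)) / \<omega>"

definition rs_nag_m :: "real \<Rightarrow> real \<Rightarrow> real" where
  "rs_nag_m L l = 1 / (2 * L * l)"

fun rs_nag_x :: "(real^'d \<Rightarrow> real^'d) \<Rightarrow> real \<Rightarrow> real \<Rightarrow> real \<Rightarrow> (nat \<Rightarrow> real^'r^'d) \<Rightarrow> real^'d \<Rightarrow> nat \<Rightarrow> real^'d"
  and rs_nag_y :: "(real^'d \<Rightarrow> real^'d) \<Rightarrow> real \<Rightarrow> real \<Rightarrow> real \<Rightarrow> (nat \<Rightarrow> real^'r^'d) \<Rightarrow> real^'d \<Rightarrow> nat \<Rightarrow> real^'d"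
  and rs_nag_z :: "(real^'d \<Rightarrow> real^'d) \<Rightarrow> real \<Rightarrow> real \<Rightarrow> real \<Rightarrow> (nat \<Rightarrow> real^'r^'d) \<Rightarrow> real^'d \<Rightarrow> nat \<Rightarrow> real^'d"
where
  "rs_nag_x g L \<omega> l S x0 0 = x0"
| "rs_nag_x g L \<omega> l S x0 (Suc k) =
     rs_nag_y g L \<omega> l S x0 k - (1 / (L * l)) *\<^sub>R (gram (S k) *v g (rs_nag_y g L \<omega> l S x0 k))"
| "rs_nag_y g L \<omega> l S x0 k =
     (rs_nag_A (rs_nag_m L l) \<omega> k / rs_nag_A (rs_nag_m L l) \<omega> (Suc k)) *\<^sub>R rs_nag_x g L \<omega> l S x0 k +
     (rs_nag_a (rs_nag_m L l) \<omega> (Suc k) / rs_nag_A (rs_nag_m L l) \<omega> (Suc k)) *\<^sub>R rs_nag_z g L \<omega> l S x0 k"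
| "rs_nag_z g L \<omega> l S x0 0 = x0"
| "rs_nag_z g L \<omega> l S x0 (Suc k) =
     rs_nag_z g L \<omega> l S x0 k -
     rs_nag_a (rs_nag_m L l) \<omega> (Suc k) *\<^sub>R (gram (S k) *v g (rs_nag_y g L \<omega> l S x0 k))"

primrec nag_t :: "nat \<Rightarrow> real" where
  "nag_t 0 = 1"
| "nag_t (Suc k) = (1 + sqrt (1 + 4 * (nag_t k)\<^sup>2)) / 2"

definition nag_beta :: "nat \<Rightarrow> real" where
  "nag_beta k = (nag_t k - 1) / nag_t (Suc k)"

fun nag_x :: "(real^'d \<Rightarrow> real^'d) \<Rightarrow> real \<Rightarrow> real^'d \<Rightarrow> nat \<Rightarrow> real^'d"
  and nag_y :: "(real^'d \<Rightarrow> real^'d) \<Rightarrow> real \<Rightarrow> real^'d \<Rightarrow> nat \<Rightarrow> real^'d" where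
  "nag_x g L x0 0 = x0"
| "nag_x g L x0 (Suc k) = nag_y g L x0 k - (1 / L) *\<^sub>R g (nag_y g L x0 k)"
| "nag_y g L x0 0 = x0"
| "nag_y g L x0 (Suc k) =
     nag_x g L x0 (Suc k) + nag_beta k *\<^sub>R (nag_x g L x0 (Suc k) - nag_x g L x0 k)"

end

(* For omega = l = 1 and gram matrices equal to the identity, the weights of RS-NAG-C are
   a_(k+1) = t_k / L and A_(k+1) = t_k^2 / L, so y_k averages x_k and z_k with weights
   1 - 1/t_k and 1/t_k.  Hence z_(k+1) = x_k + t_k (x_(k+1) - x_k), which turns y_(k+1) into
   the Nesterov extrapolation step with coefficient (t_k - 1) / t_(k+1). *)
theory Submission
  imports Defs
begin

lemma nag_t_ge_1: "nag_t k \<ge> 1"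
proof (cases k)
  case (Suc j)
  have "sqrt (1 + 4 * (nag_t j)\<^sup>2) \<ge> 1" by simp
  then show ?thesis using Suc by simp
qed simp

text \<open>The update picks the positive root of \<open>t^2 - t - (nag_t k)^2 = 0\<close>. This
  matches \<open>A_(k+1) = A_k + a_(k+1)\<close> up to a factor.\<close>

lemma nag_t_Suc_square: "(nag_t (Suc k))\<^sup>2 = nag_t (Suc k) + (nag_t k)\<^sup>2"
proof -
  define q where "q = sqrt (1 + 4 * (nag_t k)\<^sup>2)"
  have "q\<^sup>2 = 1 + 4 * (nag_t k)\<^sup>2" unfolding q_def by simp
  moreover have "nag_t (Suc k) = (1 + q) / 2" by (simp add: q_def)
  ultimately show ?thesis by (simp add: power2_eq_square field_simps)
qed

text \<open>Induction starts at index 1 because \<open>A_0 = 0\<close> gives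
  \<open>a_1 = A_1 = 2 * m\<close>. Since \<open>m > 0\<close>, \<open>m\<close> can be pulled out
  of the square root, leaving the recursion of \<open>nag_t\<close> scaled by
  \<open>2 * m\<close>.\<close>

lemma rs_nag_weights:
  assumes m: "m > 0"
  shows "rs_nag_a m 1 (Suc k) = 2 * m * nag_t k \<and> rs_nag_A m 1 (Suc k) = 2 * m * (nag_t k)\<^sup>2"
proof (induction k)
  case 0
  show ?case using m by simp
next
  case (Suc k)
  have "m\<^sup>2 + 2 * 1 * m * rs_nag_A m 1 (Suc k) = m\<^sup>2 * (1 + 4 * (nag_t k)\<^sup>2)"
    using Suc by (simp add: power2_eq_square algebra_simps del: rs_nag_A.simps)
  then have "rs_nag_a m 1 (Suc (Suc k)) = m + m * sqrt (1 + 4 * (nag_t k)\<^sup>2)"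
    using m by (simp add: real_sqrt_mult del: rs_nag_A.simps)
  also have "\<dots> = 2 * m * nag_t (Suc k)" by (simp add: algebra_simps)
  finally have a: "rs_nag_a m 1 (Suc (Suc k)) = 2 * m * nag_t (Suc k)" .
  have "rs_nag_A m 1 (Suc (Suc k)) = 2 * m * (nag_t k)\<^sup>2 + 2 * m * nag_t (Suc k)"
    using Suc a by (simp only: rs_nag_A.simps(2)[of m 1 "Suc k"])
  also have "\<dots> = 2 * m * (nag_t (Suc k))\<^sup>2"
    by (simp only: nag_t_Suc_square distrib_left add.commute)
  finally show ?case using a by blast
qed

lemma rs_nag_eq_nag:
  fixes S :: "nat \<Rightarrow> real^'r^'d"
  assumes L: "L > 0" and S: "\<And>k. gram (S k) = mat 1"
  shows "rs_nag_x g L 1 1 S x0 k = nag_x g L x0 k \<and> rs_nag_y g L 1 1 S x0 k = nag_y g L x0 k"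
proof -
  define m where "m = rs_nag_m L 1"
  have m: "m > 0" "2 * m = 1 / L" using L by (auto simp: m_def rs_nag_m_def)
  let ?x = "nag_x g L x0" and ?y = "nag_y g L x0" and ?t = nag_t
  let ?z = "rs_nag_z g L 1 1 S x0"
  have t: "?t k > 0" for k using nag_t_ge_1[of k] by linarith
  note weights = rs_nag_weights[OF m(1)]
  \<comment> \<open>Solve the averaging identity for \<open>z_k\<close>, then subtract
    \<open>(t_k / L) g(y_k)\<close>: the term \<open>t_k y_k\<close> becomes
    \<open>t_k x_(k+1)\<close>.\<close>
  have step: "rs_nag_z g L 1 1 S x0 (Suc k) = ?x k + ?t k *\<^sub>R (?x (Suc k) - ?x k)"
    if "?y k = (1 - 1 / ?t k) *\<^sub>R ?x k + (1 / ?t k) *\<^sub>R ?z k"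
      and "rs_nag_y g L 1 1 S x0 k = ?y k" for k
  proof -
    have "?t k *\<^sub>R ?y k = (?t k - 1) *\<^sub>R ?x k + ?z k"
      using t[of k] that(1) by (simp add: scaleR_add_right right_diff_distrib)
    then have z: "?z k = ?t k *\<^sub>R ?y k - (?t k - 1) *\<^sub>R ?x k" by simp
    have "?z (Suc k) = ?z k - (?t k / L) *\<^sub>R g (?y k)"
      using weights[of k] that(2) m(2)
      by (simp add: S m_def[symmetric] del: rs_nag_a.simps rs_nag_y.simps)
    then show ?thesis by (simp add: z algebra_simps)
  qed
  \<comment> \<open>The third conjunct strengthens the induction: it is the premise that
    \<open>step\<close> needs to produce the next \<open>z\<close>.\<close>
  have "rs_nag_x g L 1 1 S x0 k = ?x k \<and> rs_nag_y g L 1 1 S x0 k = ?y k \<and>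
      ?y k = (1 - 1 / ?t k) *\<^sub>R ?x k + (1 / ?t k) *\<^sub>R ?z k"
  proof (induction k)
    case 0
    \<comment> \<open>Here \<open>A_0 = 0\<close> and \<open>t_0 = 1\<close>, so all weight lies on
      \<open>z_0 = x0\<close>.\<close>
    show ?case using m(1) by (simp add: m_def[symmetric])
  next
    case (Suc k)
    have x: "rs_nag_x g L 1 1 S x0 (Suc k) = ?x (Suc k)"
      using Suc by (simp add: S del: rs_nag_y.simps)
    have z: "?z (Suc k) = ?x k + ?t k *\<^sub>R (?x (Suc k) - ?x k)"
      using Suc step by blast
    have "rs_nag_A m 1 (Suc k) / rs_nag_A m 1 (Suc (Suc k)) = (?t k)\<^sup>2 / (?t (Suc k))\<^sup>2"
      using weights[of k] weights[of "Suc k"] m(1)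
      by (simp del: rs_nag_A.simps rs_nag_a.simps nag_t.simps)
    also have "\<dots> = 1 - 1 / ?t (Suc k)"
    proof -
      have "(?t k)\<^sup>2 = (?t (Suc k))\<^sup>2 - ?t (Suc k)" using nag_t_Suc_square[of k] by linarith
      then show ?thesis
        using t[of "Suc k"] by (simp add: diff_divide_distrib power2_eq_square del: nag_t.simps)
    qed
    finally have c1: "rs_nag_A m 1 (Suc k) / rs_nag_A m 1 (Suc (Suc k)) = 1 - 1 / ?t (Suc k)" .
    have c2: "rs_nag_a m 1 (Suc (Suc k)) / rs_nag_A m 1 (Suc (Suc k)) = 1 / ?t (Suc k)"
      using weights[of "Suc k"] m(1) t[of "Suc k"]
      by (simp add: field_simps power2_eq_square del: nag_t.simps rs_nag_a.simps rs_nag_A.simps)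
    have ry: "rs_nag_y g L 1 1 S x0 (Suc k) =
        (1 - 1 / ?t (Suc k)) *\<^sub>R ?x (Suc k) + (1 / ?t (Suc k)) *\<^sub>R ?z (Suc k)"
      by (simp only: rs_nag_y.simps[of g L 1 1 S x0 "Suc k"] m_def[symmetric] c1 c2 x)
    \<comment> \<open>With \<open>u = 1 / t_(k+1)\<close>, inserting \<open>z\<close> leaves
      \<open>x_(k+1) + u (t_k - 1) (x_(k+1) - x_k)\<close>.\<close>
    have "(1 - 1 / ?t (Suc k)) *\<^sub>R ?x (Suc k) + (1 / ?t (Suc k)) *\<^sub>R ?z (Suc k)
        = ?y (Suc k)"
    proof -
      define u where "u = 1 / ?t (Suc k)"
      have beta: "nag_beta k = (?t k - 1) * u" by (simp add: nag_beta_def u_def)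
      show ?thesis
        unfolding z u_def[symmetric] nag_y.simps beta by (simp add: algebra_simps del: nag_x.simps)
    qed
    with x ry show ?case by metis
  qed
  then show ?thesis by blast
qed

text \<open>Each entry of a Gram matrix is a sum over columns, which a bijection merely reindexes.
  This bridges the distinct index types \<open>'r\<close> and \<open>'d\<close>.\<close>

lemma gram_column_permutation:
  fixes A :: "real^'d^'d" and c :: "'r::finite \<Rightarrow> 'd"
  assumes "bij c"
  shows "gram (\<chi> i j. A $ i $ c j) = gram A"
  by (simp add: vec_eq_iff matrix_matrix_mult_def transpose_def
      sum.reindex_bij_betw[OF assms, where g = "\<lambda>k. A $ i $ k * A $ j $ k" for i j])

lemma inj_imp_bij_CARD:
  fixes c :: "'r::finite \<Rightarrow> 'd::finite"
  assumes "inj c" "CARD('r) = CARD('d)"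
  shows "bij c"
  using assms by (metis bij_def card_image card_subset_eq finite_UNIV subset_UNIV finite_code)

text \<open>For equal dimensions the scaling factor is 1, and the sketch is almost surely an
  orthogonal matrix with relabelled columns.\<close>

lemma haar_sketch_gram:
  fixes P :: "'w \<Rightarrow> real^'r^'d"
  assumes "haar_sketch M P" and full: "CARD('r) = CARD('d)"
  shows "AE w in M. gram (P w) = mat 1"
proof -
  obtain Q :: "'w \<Rightarrow> real^'d^'d" and c :: "'r \<Rightarrow> 'd" where
    Q: "AE w in M. orthogonal_matrix (Q w)" and "inj c" and
    P: "\<forall>w\<in>space M. P w = (\<chi> i j. Q w $ i $ c j)"
    using assms by (auto simp: haar_sketch_def haar_orthogonal_def)
  then have "bij c" using full by (simp add: inj_imp_bij_CARD)
  from Q AE_space show ?thesis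
    by eventually_elim (simp add: P gram_column_permutation[OF \<open>bij c\<close>] orthogonal_matrix_def)
qed

text \<open>Sampling all columns without repetition yields the identity with its columns
  relabelled.\<close>

lemma coordinate_sketch_gram:
  fixes P :: "'w \<Rightarrow> real^'r^'d"
  assumes "coordinate_sketch M P" and full: "CARD('r) = CARD('d)"
  shows "AE w in M. gram (P w) = mat 1"
proof -
  obtain s :: "'w \<Rightarrow> 'r \<Rightarrow> 'd" where
    s: "AE w in M. inj (s w)" and
    P: "\<forall>w\<in>space M. P w = (\<chi> i j. (mat 1 :: real^'d^'d) $ i $ s w j)"
    using assms by (auto simp: coordinate_sketch_def)
  from s AE_space show ?thesis
    by eventually_elim (simp add: P gram_column_permutation inj_imp_bij_CARD full transpose_mat)
qed

text \<open>The moment conditions concern \<open>P\<close>, while the Gram identity is assumed for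
  the copies; equality in law transfers this almost sure event.\<close>

lemma iid_copies_gram:
  fixes P :: "'w \<Rightarrow> real^'r^'d"
  assumes "prob_space M" and P: "P \<in> borel_measurable M" and iid: "iid_copies M P Ps"
    and AE: "AE w in M. gram (Ps k w) = mat 1"
  shows "AE w in M. gram (P w) = mat 1"
proof -
  interpret prob_space M by fact
  have Ps: "Ps k \<in> borel_measurable M" and d: "distr M borel (Ps k) = distr M borel P"
    using iid by (auto simp: iid_copies_def indep_vars_def)
  \<comment> \<open>Closedness gives the Borel measurability needed to read the event off the
    law.\<close>
  have "closed {A :: real^'r^'d. gram A = mat 1}"
    unfolding matrix_matrix_mult_def transpose_def
    by (intro closed_Collect_eq continuous_intros)
  then have *: "{A :: real^'r^'d \<in> space borel. gram A = mat 1} \<in> sets borel" by simp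
  show ?thesis
    using AE_distr_iff[OF Ps *] AE_distr_iff[OF P *] d AE by metis
qed

text \<open>Cauchy-Schwarz and the operator norm bound control the quadratic form. This is the third
  moment condition with \<open>l = 1\<close>, where the expectation is \<open>A\<close>
  itself.\<close>

lemma psd_loewner_le_op_norm:
  fixes A :: "real^'d^'d"
  assumes "psd A"
  shows "A \<preceq> op_norm A *\<^sub>R mat 1"
  unfolding loewner_le_def psd_def
proof (intro conjI allI)
  have sym: "transpose A = A" using assms by (simp add: psd_def)
  show "transpose (op_norm A *\<^sub>R mat 1 - A) = op_norm A *\<^sub>R mat 1 - A"
    using arg_cong[OF sym, of "\<lambda>B. B $ _ $ _"]
    by (auto simp: vec_eq_iff transpose_def mat_def)
  fix x :: "real^'d"
  have "x \<bullet> (A *v x) \<le> norm x * norm (A *v x)" by (rule norm_cauchy_schwarz)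
  also have "\<dots> \<le> norm x * (op_norm A * norm x)"
    by (intro mult_left_mono onorm matrix_vector_mul_bounded_linear norm_ge_zero)
  also have "\<dots> = op_norm A * (x \<bullet> x)" by (simp add: dot_square_norm power2_eq_square)
  finally show "0 \<le> x \<bullet> ((op_norm A *\<^sub>R mat 1 - A) *v x)"
    by (simp add: matrix_vector_mult_diff_rdistrib inner_diff_right
        scaleR_matrix_vector_assoc[symmetric])
qed

text \<open>Integrability and the mean carry over from the given constants. The other two integrands
  are almost surely constant, so their integrals over a probability space are those
  constants.\<close>

lemma sketch_moments_full:
  fixes P :: "'w \<Rightarrow> real^'r^'d"
  assumes "prob_space M" and mom: "sketch_moments M P \<L> \<omega> l" and "psd \<L>"
    and gram: "AE w in M. gram (P w) = mat 1"
  shows "sketch_moments M P \<L> 1 1"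
proof -
  interpret prob_space M by fact
  have "(\<integral>w. gram (P w) ** gram (P w) \<partial>M) = (\<integral>w. mat 1 \<partial>M)"
    using mom gram by (intro integral_cong_AE) (auto simp: sketch_moments_def)
  moreover have "(\<integral>w. gram (P w) ** \<L> ** gram (P w) \<partial>M) = (\<integral>w. \<L> \<partial>M)"
    using mom gram by (intro integral_cong_AE) (auto simp: sketch_moments_def)
  moreover have "(mat 1 :: real^'d^'d) \<preceq> 1 *\<^sub>R mat 1"
    by (simp add: loewner_le_def psd_def transpose_def vec_eq_iff)
  ultimately show ?thesis
    using mom psd_loewner_le_op_norm[OF \<open>psd \<L>\<close>] by (simp add: sketch_moments_def prob_space)
qed

text \<open>A nonzero matrix acts as a nonzero linear map. Positivity makes the step size
  \<open>1 / L\<close> and the weight \<open>m\<close> positive.\<close>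

lemma op_norm_pos:
  fixes A :: "real^'d^'d"
  assumes "A \<noteq> 0"
  shows "op_norm A > 0"
proof -
  have "\<exists>x. A *v x \<noteq> 0 *v x" using assms by (metis matrix_eq)
  then show ?thesis
    by (simp add: onorm_pos_lt matrix_vector_mul_bounded_linear)
qed

theorem proposition3p2:
  fixes f :: "real^'d \<Rightarrow> real"
    and \<L> :: "real^'d^'d"
    and M :: "'w measure"
    and P :: "'w \<Rightarrow> real^'r^'d"
    and Ps :: "nat \<Rightarrow> 'w \<Rightarrow> real^'r^'d"
    and \<omega> l :: real
    and x0 :: "real^'d"
  assumes dim: "CARD('d) \<ge> 2"
    and differentiable: "\<And>x. f differentiable (at x)"
    and convex: "convex_on UNIV f"
    and minimizer: "\<exists>xmin. \<forall>x. f xmin \<le> f x"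
    and smooth: "matrix_smooth \<L> f"
    and prob: "prob_space M"
    and moments: "sketch_moments M P \<L> \<omega> l"
    and iid: "iid_copies M P Ps"
    and full: "CARD('r) = CARD('d)"
    and gram_id: "AE w in M. \<forall>k. Ps k w ** transpose (Ps k w) = mat 1"
  shows "(\<forall>Q :: nat \<Rightarrow> 'w \<Rightarrow> real^'r^'d.
            (\<forall>k. haar_sketch M (Q k)) \<or> (\<forall>k. coordinate_sketch M (Q k)) \<longrightarrow>
            (AE w in M. \<forall>k. Q k w ** transpose (Q k w) = mat 1)) \<and>
         sketch_moments M P \<L> 1 1 \<and>
         (AE w in M. \<forall>k.
            rs_nag_x (gradient f) (op_norm \<L>) 1 1 (\<lambda>j. Ps j w) x0 k = nag_x (gradient f) (op_norm \<L>) x0 k \<and>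
            rs_nag_y (gradient f) (op_norm \<L>) 1 1 (\<lambda>j. Ps j w) x0 k = nag_y (gradient f) (op_norm \<L>) x0 k)"
proof (intro conjI allI impI)
  fix Q :: "nat \<Rightarrow> 'w \<Rightarrow> real^'r^'d"
  assume "(\<forall>k. haar_sketch M (Q k)) \<or> (\<forall>k. coordinate_sketch M (Q k))"
  then show "AE w in M. \<forall>k. Q k w ** transpose (Q k w) = mat 1"
    \<comment> \<open>Countably many null sets, one for each \<open>k\<close>, are merged into
      one.\<close>
    using full by (auto simp: AE_all_countable haar_sketch_gram coordinate_sketch_gram)
next
  have "AE w in M. gram (P w) = mat 1"
    using gram_id moments
    by (intro iid_copies_gram[OF prob _ iid, where k = 0]) (auto simp: sketch_moments_def)
  then show "sketch_moments M P \<L> 1 1"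
    using sketch_moments_full[OF prob moments] smooth by (simp add: matrix_smooth_def)
next
  have "op_norm \<L> > 0" using smooth by (simp add: matrix_smooth_def op_norm_pos)
  from gram_id show "AE w in M. \<forall>k.
      rs_nag_x (gradient f) (op_norm \<L>) 1 1 (\<lambda>j. Ps j w) x0 k = nag_x (gradient f) (op_norm \<L>) x0 k \<and>
      rs_nag_y (gradient f) (op_norm \<L>) 1 1 (\<lambda>j. Ps j w) x0 k = nag_y (gradient f) (op_norm \<L>) x0 k"
    \<comment> \<open>The comparison is pathwise: off one null set, the deterministic lemma applies
      to the realized sketch sequence.\<close>
    by eventually_elim (rule allI, rule rs_nag_eq_nag[OF \<open>op_norm \<L> > 0\<close>], blast)
qed

end
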